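(* Let $n\geq 4$ and let $B\subset\mathbb{R}^{n+1}$ be a symmetric convex body all of whose hyperplane sections are affine symmetric bodies of revolution (not assumed linearly equivalent to each other). Then at least one hyperplane section of $B$ is an ellipsoid.
   Context: A symmetric convex body is a compact convex subset of a finite-dimensional real vector space with nonempty interior, invariant under $x\mapsto -x$. A hyperplane is a codimension-one linear subspace; a hyperplane section of a set is its intersection with a hyperplane. A symmetric convex body $K\subset\mathbb{R}^m$ is a symmetric body of revolution if it admits an axis of revolution: a 1-dimensional linear subspace $L$ such that every section of $K$ by an affine hyperplane $A$ orthogonal to $L$ is a closed Euclidean $(m-1)$-ball in $A$ centered at $A\cap L$ (possibly empty or a point); $L^\perp$ is the associated hyperplane of revolution. An affine symmetric body of revolution is a convex body linearly equivalent (via a linear isomorphism of ambient spaces) to a symmetric body of revolution; images of an axis and its associated hyperplane of revolution are called an axis and associated hyperplane of revolution of it. An ellipsoid is a set affinely equivalent to a closed Euclidean unit ball. *)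

theory Defs
  imports "HOL-Analysis.Analysis"
begin

text \<open>Finite-dimensional real vector spaces are modelled as linear subspaces V of a
  Euclidean space, with the induced inner product (every m-dimensional Euclidean
  space is linearly isometric to any m-dimensional subspace).\<close>

definition sym_convex_body_in :: "'a::euclidean_space set \<Rightarrow> 'a set \<Rightarrow> bool" where
  "sym_convex_body_in V K \<longleftrightarrow> subspace V \<and> K \<subseteq> V \<and> compact K \<and> convex K
     \<and> (\<exists>x\<in>K. \<exists>e>0. V \<inter> ball x e \<subseteq> K)
     \<and> (\<forall>x\<in>K. - x \<in> K)"

text \<open>Axis of revolution L = span {u}; the affine hyperplanes of V orthogonal to L are
  the sets {x \<in> V. x \<bullet> u = t}; each meets L in (t / (u . u)) u. A closed ball
  A \<inter> cball c r with r < 0 is empty, with r = 0 a point.\<close>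
definition sym_body_of_revolution_in :: "'a::euclidean_space set \<Rightarrow> 'a set \<Rightarrow> bool" where
  "sym_body_of_revolution_in V K \<longleftrightarrow> sym_convex_body_in V K \<and>
     (\<exists>u\<in>V. u \<noteq> 0 \<and> (\<forall>t::real. \<exists>r::real.
        K \<inter> {x\<in>V. x \<bullet> u = t} = {x\<in>V. x \<bullet> u = t} \<inter> cball ((t / (u \<bullet> u)) *\<^sub>R u) r))"

definition affine_sym_body_of_revolution_in :: "'a::euclidean_space set \<Rightarrow> 'a set \<Rightarrow> bool" where
  "affine_sym_body_of_revolution_in H S \<longleftrightarrow>
     (\<exists>(W::'a set) K (f::'a \<Rightarrow> 'a). subspace W \<and> dim W = dim H \<and> sym_body_of_revolution_in W K \<and>
        linear f \<and> inj_on f W \<and> f ` W = H \<and> S = f ` K)"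

definition ellipsoid_in :: "'a::euclidean_space set \<Rightarrow> 'a set \<Rightarrow> bool" where
  "ellipsoid_in H S \<longleftrightarrow>
     (\<exists>(W::'a set) (f::'a \<Rightarrow> 'a) c. subspace W \<and> dim W = dim H \<and> linear f \<and> inj_on f W \<and> f ` W = H \<and> c \<in> H \<and>
        S = (\<lambda>x. f x + c) ` (W \<inter> cball 0 1))"

definition linear_hyperplane :: "'a::euclidean_space set \<Rightarrow> bool" where
  "linear_hyperplane H \<longleftrightarrow> subspace H \<and> dim H = DIM('a) - 1"

end

theory Submission
  imports Defs
begin

text \<open>
  Let N be the norm with unit ball B, and suppose that no hyperplane section is an ellipsoid. The section
  by a hyperplane of revolution is always an ellipsoid. Hence an axis L of one section cannot lie in a
  hyperplane of revolution H of another (or the same) section: the dimension bound gives a plane through L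
  in H on which N is Euclidean, and this profile forces the section with axis L to be an ellipsoid.

  This transversality makes the axis of each section unique. If two axes of the same section were
  distinct, half turns about them would generate an arithmetic progression of axis vectors, contradicting
  boundedness. So the axis depends continuously on the normal x of the hyperplane. Fix one
  hyperplane of revolution H and project the axes to the plane orthogonal to H. By transversality the
  projections never vanish, so their squares, as complex numbers, define a continuous map from the sphere
  to the punctured plane, which has a logarithm since the sphere is simply connected. On the unit circle
  orthogonal to H the axis is orthogonal to x, so the map winds twice, which is impossible.
\<close>

section \<open>Norms and the gauge of a symmetric convex body\<close>

locale gauge_norm =
  fixes N :: "'a::euclidean_space \<Rightarrow> real"
  assumes scale: "N (c *\<^sub>R v) = \<bar>c\<bar> * N v"
    and triangle: "N (u + v) \<le> N u + N v"
    and pos: "v \<noteq> 0 \<Longrightarrow> N v > 0"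
begin

lemma zero [simp]: "N 0 = 0"
  using scale[of 0 0] by simp

lemma minus [simp]: "N (- v) = N v"
  using scale[of "-1" v] by simp

lemma nonneg [simp]: "N v \<ge> 0"
  using pos[of v] by (cases "v = 0") auto

lemma eq_zero_iff: "N v = 0 \<longleftrightarrow> v = 0"
  using pos[of v] by (cases "v = 0") auto

lemma upper_bound: "\<exists>C>0. \<forall>v. N v \<le> C * norm v"
proof (intro exI conjI allI)
  have sum_le: "N (\<Sum>b\<in>S. f b) \<le> (\<Sum>b\<in>S. N (f b))" if "finite S" for S :: "'a set" and f
    using that
  proof (induction S rule: finite_induct)
    case (insert b S)
    then show ?case using triangle[of "f b" "\<Sum>b\<in>S. f b"] by simp
  qed simp
  have C0: "(\<Sum>b\<in>Basis. N b) \<ge> 0" by (simp add: sum_nonneg)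
  then show "(\<Sum>b\<in>Basis. N b) + 1 > 0" by linarith
  fix v :: 'a
  have "N v = N (\<Sum>b\<in>Basis. (v \<bullet> b) *\<^sub>R b)"
    by (simp add: euclidean_representation)
  also have "\<dots> \<le> (\<Sum>b\<in>Basis. \<bar>v \<bullet> b\<bar> * N b)"
    using sum_le[of Basis "\<lambda>b. (v \<bullet> b) *\<^sub>R b"] by (simp add: scale)
  also have "\<dots> \<le> (\<Sum>b\<in>Basis. norm v * N b)"
    by (intro sum_mono mult_right_mono) (auto simp: Basis_le_norm)
  also have "\<dots> \<le> ((\<Sum>b\<in>Basis. N b) + 1) * norm v"
    by (simp add: sum_distrib_left[symmetric] mult.commute[of _ "norm v"] mult_left_mono)
  finally show "N v \<le> ((\<Sum>b\<in>Basis. N b) + 1) * norm v" .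
qed

lemma continuous: "continuous_on S N"
proof -
  obtain C where C: "C > 0" "\<And>v. N v \<le> C * norm v" using upper_bound by blast
  have le: "N u - N v \<le> C * norm (u - v)" for u v
    using triangle[of "u - v" v] C(2)[of "u - v"] by simp
  have "C-lipschitz_on UNIV N"
    using C(1) le by (auto simp: lipschitz_on_def dist_norm abs_le_iff) (metis minus_diff_eq norm_minus_cancel)
  then show ?thesis
    by (metis lipschitz_on_continuous_on continuous_on_subset subset_UNIV)
qed

lemma lower_bound: "\<exists>C>0. \<forall>v. norm v \<le> C * N v"
proof -
  have "compact (sphere (0::'a) 1)" "sphere (0::'a) 1 \<noteq> {}" by auto
  then obtain s where s: "s \<in> sphere 0 1" "\<And>v. v \<in> sphere 0 1 \<Longrightarrow> N s \<le> N v"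
    using continuous_attains_inf[OF _ _ continuous, of "sphere 0 1"] by metis
  then have "N s > 0" by (intro pos) auto
  have "norm v \<le> (1 / N s) * N v" for v
  proof (cases "v = 0")
    case False
    then have "N s \<le> N ((1 / norm v) *\<^sub>R v)" by (intro s(2)) simp
    then show ?thesis using False \<open>N s > 0\<close> by (simp add: scale field_simps)
  qed simp
  then show ?thesis using \<open>N s > 0\<close> by (intro exI[of _ "1 / N s"]) auto
qed

text \<open>A body of revolution only tells which vectors lie in scaled copies of the unit ball;
  this recovers the norm from them.\<close>

lemma eqI:
  assumes "\<And>s. s > 0 \<Longrightarrow> N u \<le> s \<longleftrightarrow> N v \<le> s"
  shows "N u = N v"
proof (rule antisym)
  show "N u \<le> N v" by (rule field_le_epsilon) (use assms in \<open>smt (verit) nonneg\<close>)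
  show "N v \<le> N u" by (rule field_le_epsilon) (use assms in \<open>smt (verit) nonneg\<close>)
qed

lemma le_iff_scaled: "s > 0 \<Longrightarrow> N v \<le> s \<longleftrightarrow> N ((1 / s) *\<^sub>R v) \<le> 1"
  by (simp add: scale field_simps)

end

text \<open>\<open>N\<close> is the Minkowski functional of \<open>B\<close>. Convexity gives the
  triangle inequality, boundedness gives positivity, and closedness makes the unit ball exactly
  \<open>B\<close>.\<close>

lemma sym_convex_body_gauge:
  fixes B :: "'a::euclidean_space set"
  assumes "sym_convex_body_in UNIV B"
  obtains N where "gauge_norm N" "B = {v. N v \<le> 1}"
proof -
  have cB: "compact B" "convex B" and sym: "\<And>v. v \<in> B \<Longrightarrow> - v \<in> B"
    using assms unfolding sym_convex_body_in_def by auto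
  obtain x d where xd: "x \<in> B" "d > 0" "ball x d \<subseteq> B"
    using assms unfolding sym_convex_body_in_def by auto
  \<comment> \<open>The vector \<open>v\<close> is the midpoint of \<open>x + 2 *\<^sub>R v\<close>
    and \<open>- x\<close>, so symmetry moves the interior ball to the origin.\<close>
  have ball: "v \<in> B" if "norm v < d / 2" for v
  proof -
    have "x + 2 *\<^sub>R v \<in> B" using that xd(3) by (auto simp: dist_norm)
    then have "(1/2) *\<^sub>R (x + 2 *\<^sub>R v) + (1/2) *\<^sub>R (- x) \<in> B"
      using cB(2) sym[OF xd(1)] by (intro convexD) auto
    then show ?thesis by (simp add: algebra_simps)
  qed
  have B0: "0 \<in> B" using ball[of 0] xd(2) by simp
  obtain R where R: "R > 0" "\<And>v. v \<in> B \<Longrightarrow> norm v \<le> R"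
    using cB(1) compact_imp_bounded bounded_pos by metis
  define A where "A v = {t. 0 < t \<and> (1 / t) *\<^sub>R v \<in> B}" for v
  define N where "N v = Inf (A v)" for v
  have ne: "A v \<noteq> {}" for v
  proof -
    have "norm v * (d / (2 * norm v + 2)) < d / 2" using xd(2) by (auto simp: field_simps add_pos_nonneg)
    then have "(1 / ((2 * norm v + 2) / d)) *\<^sub>R v \<in> B" using xd(2) by (intro ball) (simp add: field_simps)
    then have "(2 * norm v + 2) / d \<in> A v" using xd(2) by (simp add: A_def add_nonneg_pos)
    then show ?thesis by blast
  qed
  have bdd: "bdd_below (A v)" for v by (rule bdd_belowI[of _ 0]) (auto simp: A_def)
  have up: "s \<in> A v" if "t \<in> A v" "t \<le> s" for s t v
  proof -
    have "0 < t" "(1 / t) *\<^sub>R v \<in> B" using that by (auto simp: A_def)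
    then have "(t / s) *\<^sub>R ((1 / t) *\<^sub>R v) + (1 - t / s) *\<^sub>R 0 \<in> B"
      using cB(2) B0 that(2) by (intro convexD) auto
    then show ?thesis using \<open>0 < t\<close> that(2) by (simp add: A_def)
  qed
  have key: "N v \<le> t \<longleftrightarrow> (1 / t) *\<^sub>R v \<in> B" if "t > 0" for v t
  proof
    assume "(1 / t) *\<^sub>R v \<in> B"
    then show "N v \<le> t" unfolding N_def using that by (intro cInf_lower bdd) (simp add: A_def)
  next
    assume le: "N v \<le> t"
    \<comment> \<open>All scales above the infimum are admissible; closedness of \<open>B\<close>
      then passes to the limit scale \<open>t\<close>.\<close>
    have mem: "(1 / (t + 1 / real (Suc n))) *\<^sub>R v \<in> B" for n
    proof -
      have "N v < t + 1 / real (Suc n)" using le by (rule le_less_trans) simp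
      then obtain s where "s \<in> A v" "s < t + 1 / real (Suc n)"
        unfolding N_def using cInf_lessD[OF ne] by blast
      then show ?thesis using up[of s v "t + 1 / real (Suc n)"] by (simp add: A_def)
    qed
    have "(\<lambda>n. (1 / (t + 1 / real (Suc n))) *\<^sub>R v) \<longlonglongrightarrow> (1 / (t + 0)) *\<^sub>R v"
      using that by (intro tendsto_intros LIMSEQ_Suc[OF lim_1_over_n]) auto
    then show "(1 / t) *\<^sub>R v \<in> B"
      using closed_sequentially[OF compact_imp_closed[OF cB(1)] mem] by simp
  qed
  have nn: "N v \<ge> 0" for v unfolding N_def by (rule cInf_greatest[OF ne]) (auto simp: A_def)
  have eqI: "a = b" if "a \<ge> 0" "b \<ge> 0" "\<And>t. t > 0 \<Longrightarrow> a \<le> t \<longleftrightarrow> b \<le> t" for a b :: real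
    using that(3)[of a] that(3)[of b] that(3)[of "a/2"] that(3)[of "b/2"] that(1,2) by (smt (verit) field_sum_of_halves)
  have symB: "- v \<in> B \<longleftrightarrow> v \<in> B" for v using sym[of v] sym[of "- v"] by auto
  have "gauge_norm N"
  proof
    show "N (c *\<^sub>R v) = \<bar>c\<bar> * N v" for c v
    proof (rule eqI)
      fix t :: real assume t: "t > 0"
      show "N (c *\<^sub>R v) \<le> t \<longleftrightarrow> \<bar>c\<bar> * N v \<le> t"
      proof (cases "c = 0")
        case True
        then show ?thesis using key[OF t, of 0] B0 t by simp
      next
        case False
        have "\<bar>c\<bar> * N v \<le> t \<longleftrightarrow> N v \<le> t / \<bar>c\<bar>" using False by (simp add: field_simps)
        also have "\<dots> \<longleftrightarrow> (\<bar>c\<bar> / t) *\<^sub>R v \<in> B" using key[of "t / \<bar>c\<bar>" v] t False by simp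
        also have "\<dots> \<longleftrightarrow> (c / t) *\<^sub>R v \<in> B"
          using symB[of "(c / t) *\<^sub>R v"] by (cases "c \<ge> 0") (auto simp: abs_if)
        finally show ?thesis using key[OF t, of "c *\<^sub>R v"] by simp
      qed
    qed (use nn in auto)
    show "N (u + v) \<le> N u + N v" for u v
    proof (rule field_le_epsilon)
      fix \<epsilon> :: real assume "\<epsilon> > 0"
      define s t where "s = N u + \<epsilon> / 2" and "t = N v + \<epsilon> / 2"
      have st: "s > 0" "t > 0" using \<open>\<epsilon> > 0\<close> nn[of u] nn[of v] by (auto simp: s_def t_def)
      have "(1 / s) *\<^sub>R u \<in> B" "(1 / t) *\<^sub>R v \<in> B"
        using key[OF st(1), of u] key[OF st(2), of v] \<open>\<epsilon> > 0\<close> by (auto simp: s_def t_def)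
      then have "(s / (s + t)) *\<^sub>R ((1 / s) *\<^sub>R u) + (t / (s + t)) *\<^sub>R ((1 / t) *\<^sub>R v) \<in> B"
        using cB(2) st by (intro convexD) (auto simp flip: add_divide_distrib)
      then have "(1 / (s + t)) *\<^sub>R (u + v) \<in> B" using st by (simp add: scaleR_add_right)
      then show "N (u + v) \<le> N u + N v + \<epsilon>" using key[of "s + t" "u + v"] st by (simp add: s_def t_def)
    qed
    show "N v > 0" if "v \<noteq> 0" for v
    proof -
      have "\<not> N v \<le> 0"
      proof
        assume "N v \<le> 0"
        \<comment> \<open>This scale produces a vector of norm \<open>2 * R\<close>, beyond the
          bound \<open>R\<close> on \<open>B\<close>.\<close>
        then have "(1 / (norm v / (2 * R))) *\<^sub>R v \<in> B" using key[of "norm v / (2 * R)" v] that R(1)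
          by (smt (verit) divide_pos_pos zero_less_norm_iff)
        from R(2)[OF this] that R(1) show False by simp
      qed
      then show ?thesis by simp
    qed
  qed
  moreover have "B = {v. N v \<le> 1}" using key[of 1] by auto
  ultimately show ?thesis using that by blast
qed

section \<open>Axial data of an affine body of revolution\<close>

text \<open>
  \<open>axial N x e h T\<close>: the section of the unit ball of N by the orthogonal complement of the unit vector x
  has the axis spanned by e and the hyperplane of revolution \<open>{v. v \<bullet> x = 0 \<and> v \<bullet> h = 0}\<close>, onto which
  \<open>rev_proj x e h\<close> projects; T pulls the Euclidean norm back to N on that hyperplane. The condition on
  rotations is scaled by the norms so that all conditions are equations between continuous functions, which
  makes the set of all such \<open>(x, e, h, T)\<close> closed.
\<close>
definition rev_proj :: "'a::euclidean_space \<Rightarrow> 'a \<Rightarrow> 'a \<Rightarrow> 'a \<Rightarrow> 'a" where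
  "rev_proj x e h v = v - (v \<bullet> x) *\<^sub>R x - (v \<bullet> h) *\<^sub>R e"

definition axial :: "('a::euclidean_space \<Rightarrow> real) \<Rightarrow> 'a \<Rightarrow> 'a \<Rightarrow> 'a \<Rightarrow> ('a \<Rightarrow>\<^sub>L 'a) \<Rightarrow> bool" where
  "axial N x e h T \<longleftrightarrow> norm x = 1 \<and> e \<bullet> x = 0 \<and> h \<bullet> x = 0 \<and> h \<bullet> e = 1 \<and> N e = 1 \<and>
     (\<forall>v. N (rev_proj x e h v) = norm (T v)) \<and>
     (\<forall>t v w. N (t *\<^sub>R e + N (rev_proj x e h w) *\<^sub>R rev_proj x e h v)
            = N (t *\<^sub>R e + N (rev_proj x e h v) *\<^sub>R rev_proj x e h w))"

text \<open>A source of the dimension bounds: dimension 5 leaves room for a vector orthogonal to the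
  normals and functionals of two sections, dimension 4 for one orthogonal to three vectors in the
  half-turn argument.\<close>

lemma exists_orthogonal_list:
  fixes vs :: "'a::euclidean_space list"
  assumes "length vs < DIM('a)"
  shows "\<exists>u. u \<noteq> 0 \<and> (\<forall>v\<in>set vs. u \<bullet> v = 0)"
proof -
  have "dim (set vs) \<le> card (set vs)" by (rule dim_le_card') simp
  also have "\<dots> < DIM('a)" using assms card_length[of vs] by simp
  finally obtain u where "u \<noteq> 0" "\<And>y. y \<in> span (set vs) \<Longrightarrow> orthogonal u y"
    using orthogonal_to_subspace_exists by blast
  then show ?thesis by (intro exI[of _ u]) (auto simp: orthogonal_def span_base)
qed

context
  fixes N :: "'a::euclidean_space \<Rightarrow> real" and x e h T
  assumes ax: "axial N x e h T"
begin

lemma axialD: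
  shows "norm x = 1" "x \<bullet> x = 1" "e \<bullet> x = 0" "x \<bullet> e = 0" "h \<bullet> x = 0" "x \<bullet> h = 0" "h \<bullet> e = 1" "e \<bullet> h = 1" "N e = 1"
  using ax unfolding axial_def by (auto simp: inner_commute norm_eq_1)

lemma axial_form: "N (rev_proj x e h v) = norm (T v)"
  using ax unfolding axial_def by auto

lemma rev_proj_orth [simp]: "rev_proj x e h v \<bullet> x = 0" "rev_proj x e h v \<bullet> h = 0"
  by (simp_all add: rev_proj_def axialD inner_diff_left)

lemma rev_proj_id: "v \<bullet> x = 0 \<Longrightarrow> v \<bullet> h = 0 \<Longrightarrow> rev_proj x e h v = v"
  by (simp add: rev_proj_def)

lemma axial_form': "v \<bullet> x = 0 \<Longrightarrow> v \<bullet> h = 0 \<Longrightarrow> N v = norm (T v)"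
  using axial_form[of v] by (simp add: rev_proj_id)

lemma axial_decomp: "v \<bullet> x = 0 \<Longrightarrow> v = (v \<bullet> h) *\<^sub>R e + rev_proj x e h v"
  by (simp add: rev_proj_def)

lemma axial_rot:
  assumes "y \<bullet> x = 0" "y \<bullet> h = 0" "z \<bullet> x = 0" "z \<bullet> h = 0"
  shows "N (t *\<^sub>R e + N z *\<^sub>R y) = N (t *\<^sub>R e + N y *\<^sub>R z)"
proof -
  have "N (t *\<^sub>R e + N (rev_proj x e h z) *\<^sub>R rev_proj x e h y)
            = N (t *\<^sub>R e + N (rev_proj x e h y) *\<^sub>R rev_proj x e h z)"
    using ax unfolding axial_def by blast
  then show ?thesis using assms by (simp add: rev_proj_id)
qed

context
  assumes N: "gauge_norm N"
begin

interpretation gauge_norm N by (rule N)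

lemma axial_T_zero: "T x = 0" "T e = 0"
  using axial_form[of x] axial_form[of e]
  by (simp_all add: rev_proj_def axialD)

lemma axial_T_rev_proj: "T (rev_proj x e h v) = T v"
  by (simp add: rev_proj_def blinfun.diff_right blinfun.scaleR_right axial_T_zero)

text \<open>Divides the scaled rotation equation by the common value of \<open>N y\<close> and
  \<open>N z\<close>; if it is zero, both vectors vanish.\<close>

lemma axial_rot_eq:
  assumes "y \<bullet> x = 0" "y \<bullet> h = 0" "z \<bullet> x = 0" "z \<bullet> h = 0" and eq: "N y = N z"
  shows "N (t *\<^sub>R e + y) = N (t *\<^sub>R e + z)"
proof (cases "N z = 0")
  case True
  then show ?thesis using eq by (simp add: eq_zero_iff)
next
  case False
  have "N (N z *\<^sub>R (t *\<^sub>R e + y)) = N (N z *\<^sub>R (t *\<^sub>R e + z))"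
    using axial_rot[OF assms(1-4), of "N z * t"] eq by (simp add: scaleR_add_right)
  then show ?thesis using False by (simp add: scale)
qed

text \<open>Negating the component in the hyperplane of revolution preserves \<open>N\<close>. The
  average of \<open>v\<close> and its image is \<open>(v \<bullet> h) *\<^sub>R e\<close>, and
  \<open>N e = 1\<close>.\<close>

lemma axial_functional_le:
  assumes "v \<bullet> x = 0"
  shows "\<bar>v \<bullet> h\<bar> \<le> N v"
proof -
  let ?y = "rev_proj x e h v"
  have "N ((v \<bullet> h) *\<^sub>R e + - ?y) = N ((v \<bullet> h) *\<^sub>R e + ?y)"
    by (rule axial_rot_eq) auto
  then have eq: "N ((v \<bullet> h) *\<^sub>R e + - ?y) = N v" using axial_decomp[OF assms] by simp
  have "2 * \<bar>v \<bullet> h\<bar> = N (v + ((v \<bullet> h) *\<^sub>R e + - ?y))"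
    using scale[of "2 * (v \<bullet> h)" e] axial_decomp[OF assms] axialD(9)
    by (simp add: rev_proj_def algebra_simps assms flip: scaleR_2)
  also have "\<dots> \<le> N v + N v" using triangle eq by metis
  finally show ?thesis by simp
qed

end
end

lemma axial_uminus:
  assumes "gauge_norm N" "axial N x e h T"
  shows "axial N x (- e) (- h) T"
proof -
  interpret gauge_norm N by fact
  have P: "rev_proj x (- e) (- h) = rev_proj x e h"
    by (rule ext) (simp add: rev_proj_def)
  have "N (t *\<^sub>R - e + N (rev_proj x e h w) *\<^sub>R rev_proj x e h v)
            = N (t *\<^sub>R - e + N (rev_proj x e h v) *\<^sub>R rev_proj x e h w)" for t v w
    using axial_rot[OF assms(2), of "rev_proj x e h v" "rev_proj x e h w" "- t"] rev_proj_orth[OF assms(2)]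
    by simp
  then show ?thesis using assms(2) unfolding axial_def P by simp
qed

lemma linear_hyperplane_orth:
  fixes x :: "'a::euclidean_space"
  assumes "x \<noteq> 0"
  shows "linear_hyperplane {v. v \<bullet> x = 0}"
  using assms dim_hyperplane[OF assms] subspace_hyperplane2[of x]
  by (simp add: linear_hyperplane_def inner_commute)

text \<open>The data are carried over from the Euclidean model by \<open>f\<close> and its left
  inverse \<open>g\<close>: \<open>e\<close> is the normalised image of the axis vector
  \<open>u\<close>, \<open>h\<close> is the coordinate along \<open>u\<close>, and \<open>T\<close>
  is \<open>g\<close> after the projection, divided by the radius of the central slice.\<close>

lemma axial_exists:
  fixes N :: "'a::euclidean_space \<Rightarrow> real"
  assumes N: "gauge_norm N" and x: "norm x = 1"
    and rev: "affine_sym_body_of_revolution_in {v. v \<bullet> x = 0} ({v. N v \<le> 1} \<inter> {v. v \<bullet> x = 0})"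
  shows "\<exists>e h T. axial N x e h T"
proof -
  interpret gauge_norm N by fact
  let ?H = "{v. v \<bullet> x = 0}"
  obtain W K :: "'a set" and f where W: "subspace W" and K: "sym_body_of_revolution_in W K"
    and f: "linear f" "inj_on f W" "f ` W = ?H" and S: "{v. N v \<le> 1} \<inter> ?H = f ` K"
    using rev unfolding affine_sym_body_of_revolution_in_def by blast
  have KW: "K \<subseteq> W" using K by (auto simp: sym_body_of_revolution_in_def sym_convex_body_in_def)
  obtain u where u: "u \<in> W" "u \<noteq> 0" and r_ex: "\<forall>t::real. \<exists>r::real.
        K \<inter> {x\<in>W. x \<bullet> u = t} = {x\<in>W. x \<bullet> u = t} \<inter> cball ((t / (u \<bullet> u)) *\<^sub>R u) r"
    using K by (auto simp: sym_body_of_revolution_in_def)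
  obtain r where r: "\<And>t. K \<inter> {x\<in>W. x \<bullet> u = t} = {x\<in>W. x \<bullet> u = t} \<inter> cball ((t / (u \<bullet> u)) *\<^sub>R u) (r t)"
    using choice[OF r_ex] by blast
  have uu: "u \<bullet> u > 0" using u by simp
  have inK: "N (f (s *\<^sub>R u + w)) \<le> 1 \<longleftrightarrow> norm w \<le> r (s * (u \<bullet> u))" if w: "w \<in> W" "w \<bullet> u = 0" for s w
  proof -
    let ?v = "s *\<^sub>R u + w"
    have v: "?v \<in> W" using W u w by (simp add: subspace_add subspace_scale)
    have "f ?v \<in> ?H" using f(3) v by blast
    then have "N (f ?v) \<le> 1 \<longleftrightarrow> f ?v \<in> f ` K" by (simp flip: S)
    also have "\<dots> \<longleftrightarrow> ?v \<in> K" using f(2) KW v by (meson inj_on_image_mem_iff)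
    also have "\<dots> \<longleftrightarrow> ?v \<in> K \<inter> {x\<in>W. x \<bullet> u = s * (u \<bullet> u)}"
      using v w by (simp add: inner_add_left)
    also have "\<dots> \<longleftrightarrow> norm w \<le> r (s * (u \<bullet> u))"
      unfolding r using v w uu by (simp add: inner_add_left dist_norm)
    finally show ?thesis .
  qed
  \<comment> \<open>The slice at height 0 is a Euclidean ball of radius \<open>r 0\<close>, so
    \<open>N\<close> is Euclidean there up to this factor.\<close>
  have norm_eq: "norm w = r 0 * N (f w)" if w: "w \<in> W" "w \<bullet> u = 0" for w
  proof (cases "w = 0")
    case True
    then show ?thesis using linear_0[OF f(1)] by simp
  next
    case False
    have "f w \<noteq> f 0" using f(2) W w(1) False by (meson inj_onD subspace_0)
    then have Nw: "N (f w) > 0" using linear_0[OF f(1)] pos by simp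
    have m: "c *\<^sub>R w \<in> W" "(c *\<^sub>R w) \<bullet> u = 0" for c using w W by (auto simp: subspace_scale)
    have "norm ((1 / N (f w)) *\<^sub>R w) \<le> r 0"
      using inK[OF m, of 0 "1 / N (f w)"] Nw by (simp add: linear_cmul[OF f(1)] scale)
    then have 1: "norm w \<le> r 0 * N (f w)" using Nw by (simp add: field_simps)
    then have "r 0 > 0" using Nw False by (smt (verit) mult_nonpos_nonneg zero_less_norm_iff)
    then have "N (f ((r 0 / norm w) *\<^sub>R w)) \<le> 1"
      using inK[OF m, of 0 "r 0 / norm w"] False by simp
    then have "r 0 * N (f w) \<le> norm w"
      using \<open>r 0 > 0\<close> False by (simp add: linear_cmul[OF f(1)] scale field_simps)
    with 1 show ?thesis by simp
  qed
  obtain g where g: "linear g" "\<And>w. w \<in> W \<Longrightarrow> g (f w) = w" "\<And>v. g v \<in> W"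
    using linear_exists_left_inverse_on[OF f(1) W f(2)] by auto
  have fg: "f (g v) = v" if "v \<bullet> x = 0" for v
    using that f(3) g(2) by (metis (mono_tags, lifting) imageE mem_Collect_eq)
  have fu: "f u \<bullet> x = 0" using f(3) u(1) by auto
  have "f u \<noteq> f 0" using f(2) W u by (meson inj_onD subspace_0)
  then have Nfu: "N (f u) > 0" using linear_0[OF f(1)] pos by simp
  \<comment> \<open>The adjoint represents the functional sending \<open>v\<close> to
    \<open>g v \<bullet> u\<close>; removing its component along \<open>x\<close> does not change it
    on the section's hyperplane.\<close>
  define h0 where "h0 = adjoint g u - (adjoint g u \<bullet> x) *\<^sub>R x"
  define e where "e = (1 / N (f u)) *\<^sub>R f u"
  define h where "h = (N (f u) / (u \<bullet> u)) *\<^sub>R h0"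
  have xx: "x \<bullet> x = 1" using x by (simp add: norm_eq_1)
  have vh: "v \<bullet> h = N (f u) / (u \<bullet> u) * (g v \<bullet> u)" if "v \<bullet> x = 0" for v
    using that adjoint_works[OF g(1), of v u] by (simp add: h_def h0_def inner_diff_right)
  have basic: "e \<bullet> x = 0" "h \<bullet> x = 0" "N e = 1" "e \<bullet> h = 1"
  proof -
    show ex: "e \<bullet> x = 0" using fu by (simp add: e_def)
    show "h \<bullet> x = 0" using xx by (simp add: h_def h0_def inner_diff_left)
    show "N e = 1" using Nfu by (simp add: e_def scale)
    show "e \<bullet> h = 1" using vh[OF ex] uu Nfu by (simp add: e_def linear_cmul[OF g(1)] g(2) u(1))
  qed
  let ?P = "rev_proj x e h"
  have Px: "?P v \<bullet> x = 0" "?P v \<bullet> h = 0" for v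
    using basic xx inner_commute[of x h] by (simp_all add: rev_proj_def inner_diff_left)
  have gP: "g (?P v) \<in> W" "g (?P v) \<bullet> u = 0" "f (g (?P v)) = ?P v" for v
    using g(3) vh[OF Px(1)] Px uu Nfu fg by auto
  have normP: "norm (g (?P v)) = r 0 * N (?P v)" for v
    using norm_eq[of "g (?P v)"] gP by simp
  have linP: "linear ?P"
    by (rule linearI) (simp_all add: rev_proj_def algebra_simps)
  define T where "T = Blinfun (\<lambda>v. (1 / r 0) *\<^sub>R g (?P v))"
  have "bounded_linear (\<lambda>v. (1 / r 0) *\<^sub>R g (?P v))"
    using linear_compose[OF linP g(1)] by (intro bounded_linear_scaleR_right[THEN bounded_linear_compose])
      (simp add: linear_conv_bounded_linear o_def)
  then have T: "T v = (1 / r 0) *\<^sub>R g (?P v)" for v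
    by (simp add: T_def bounded_linear_Blinfun_apply)
  have r0: "r 0 \<ge> 0" using inK[of 0 0] linear_0[OF f(1)] W by (simp add: subspace_0)
  have form: "N (?P v) = norm (T v)" for v
  \<comment> \<open>Radius 0 forces the projection to vanish, and division by zero then makes
    \<open>T\<close> zero as well, as needed.\<close>
  proof (cases "r 0 = 0")
    case True
    then have "g (?P v) = 0" using normP[of v] by simp
    then have "?P v = 0" using gP(3)[of v] linear_0[OF f(1)] by simp
    then show ?thesis using linear_0[OF g(1)] by (simp add: T)
  next
    case False
    then show ?thesis using normP[of v] r0 by (simp add: T)
  qed
  have rot: "N (t *\<^sub>R e + N (?P w) *\<^sub>R ?P v) = N (t *\<^sub>R e + N (?P v) *\<^sub>R ?P w)" for t v w
  proof (rule eqI)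
    fix s :: real assume s: "s > 0"
    \<comment> \<open>The condition involves \<open>v\<close> only through the product of
      \<open>a\<close> and \<open>N (?P v)\<close>, which is symmetric when \<open>a\<close> is the
      norm of the other projection.\<close>
    have *: "N (t *\<^sub>R e + a *\<^sub>R ?P v) \<le> s \<longleftrightarrow> \<bar>a / s\<bar> * (r 0 * N (?P v)) \<le> r ((1 / s) * (t / N (f u)) * (u \<bullet> u))" for a v
    proof -
      have "(1 / s) *\<^sub>R (t *\<^sub>R e + a *\<^sub>R ?P v) = f (((1 / s) * (t / N (f u))) *\<^sub>R u + (a / s) *\<^sub>R g (?P v))"
        by (simp add: linear_add[OF f(1)] linear_cmul[OF f(1)] gP(3) scaleR_add_right) (simp add: e_def)
      moreover have "(a / s) *\<^sub>R g (?P v) \<in> W" "((a / s) *\<^sub>R g (?P v)) \<bullet> u = 0"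
        using gP W by (auto simp: subspace_scale)
      ultimately show ?thesis
        using inK[of "(a / s) *\<^sub>R g (?P v)" "(1 / s) * (t / N (f u))"] le_iff_scaled[OF s] normP by simp
    qed
    show "N (t *\<^sub>R e + N (?P w) *\<^sub>R ?P v) \<le> s \<longleftrightarrow> N (t *\<^sub>R e + N (?P v) *\<^sub>R ?P w) \<le> s"
      unfolding * using s by (simp add: abs_mult mult_ac)
  qed
  have "axial N x e h T"
    unfolding axial_def using x basic form rot by (simp add: inner_commute)
  then show ?thesis by blast
qed

section \<open>Transversality of axes and hyperplanes of revolution\<close>

text \<open>A vector \<open>u\<close> common to both hyperplanes of revolution spans with
  \<open>e\<close> a plane where \<open>N\<close> is Euclidean, by \<open>T1\<close>. Rotation about
  \<open>e\<close> copies this profile to every plane through \<open>e\<close> in the second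
  section.\<close>

lemma ellipsoid_of_axis_in_rev_hyperplane:
  fixes N :: "'a::euclidean_space \<Rightarrow> real"
  assumes N: "gauge_norm N" and dim: "DIM('a) \<ge> 5"
    and ax1: "axial N x1 e1 h1 T1" and ax2: "axial N x e h T"
    and e: "e \<bullet> x1 = 0" "e \<bullet> h1 = 0"
  shows "ellipsoid_in {v. v \<bullet> x = 0} ({v. N v \<le> 1} \<inter> {v. v \<bullet> x = 0})"
proof -
  interpret gauge_norm N by fact
  note D = axialD[OF ax2]
  obtain u where u: "u \<noteq> 0" "u \<bullet> x1 = 0" "u \<bullet> h1 = 0" "u \<bullet> x = 0" "u \<bullet> h = 0"
    using exists_orthogonal_list[of "[x1, h1, x, h]"] dim by auto
  have quad: "(N (a *\<^sub>R e + b *\<^sub>R u))\<^sup>2 = a\<^sup>2 + b\<^sup>2 * (N u)\<^sup>2" for a b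
  proof -
    have T1: "N (c *\<^sub>R e + d *\<^sub>R u) = norm (c *\<^sub>R T1 e + d *\<^sub>R T1 u)" for c d
      using axial_form'[OF ax1, of "c *\<^sub>R e + d *\<^sub>R u"] e u
      by (simp add: inner_add_left blinfun.add_right blinfun.scaleR_right)
    \<comment> \<open>The rotation taking \<open>u\<close> to \<open>- u\<close> fixes
      \<open>e\<close>; by polarization \<open>T1 e\<close> and \<open>T1 u\<close> are
      orthogonal.\<close>
    have "N (1 *\<^sub>R e + 1 *\<^sub>R u) = N (1 *\<^sub>R e + (-1) *\<^sub>R u)"
      using axial_rot_eq[OF ax2 N, of u "- u" 1] u by simp
    then have "norm (T1 e + T1 u) = norm (T1 e - T1 u)" unfolding T1 by simp
    then have orth: "T1 e \<bullet> T1 u = 0"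
      by (simp add: norm_eq inner_add_left inner_add_right inner_diff_left inner_diff_right inner_commute)
    have "(norm (T1 e))\<^sup>2 = 1" using T1[of 1 0] D by simp
    moreover have "N u = norm (T1 u)" using T1[of 0 1] by simp
    moreover have "(norm (a *\<^sub>R T1 e + b *\<^sub>R T1 u))\<^sup>2 = a\<^sup>2 * (norm (T1 e))\<^sup>2 + b\<^sup>2 * (norm (T1 u))\<^sup>2"
      using orth unfolding power2_norm_eq_inner by (simp add: inner_add_left inner_add_right inner_commute power2_eq_square algebra_simps)
    ultimately show ?thesis using T1 by simp
  qed
  have Nu: "N u > 0" using u(1) pos by simp
  have pyth: "(N v)\<^sup>2 = (v \<bullet> h)\<^sup>2 + (norm (T v))\<^sup>2" if v: "v \<bullet> x = 0" for v
  proof -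
    let ?y = "rev_proj x e h v"
    have "N u * N v = N (N u *\<^sub>R v)" by (simp add: scale)
    also have "N u *\<^sub>R v = (N u * (v \<bullet> h)) *\<^sub>R e + N u *\<^sub>R ?y"
      by (subst axial_decomp[OF ax2 v]) (simp add: scaleR_add_right)
    also have "N \<dots> = N ((N u * (v \<bullet> h)) *\<^sub>R e + N ?y *\<^sub>R u)"
      by (rule axial_rot[OF ax2]) (use u rev_proj_orth[OF ax2] in auto)
    finally have "(N u * N v)\<^sup>2 = (N u * (v \<bullet> h))\<^sup>2 + (N ?y)\<^sup>2 * (N u)\<^sup>2"
      using quad by simp
    then have "(N u)\<^sup>2 * (N v)\<^sup>2 = (N u)\<^sup>2 * ((v \<bullet> h)\<^sup>2 + (N ?y)\<^sup>2)"
      by (simp add: power_mult_distrib algebra_simps)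
    then show ?thesis using Nu axial_form[OF ax2] by simp
  qed
  let ?H = "{v. v \<bullet> x = 0}"
  have linT: "linear T" by (simp add: blinfun.bounded_linear_right bounded_linear.linear)
  \<comment> \<open>\<open>T\<close> kills \<open>x\<close>, so its range is proper and leaves a
    unit vector \<open>p\<close> orthogonal to it. The map \<open>M\<close> stores the axis
    coordinate along \<open>p\<close> and becomes an isometry from \<open>N\<close> to the Euclidean
    norm.\<close>
  have "\<not> inj T" using axial_T_zero[OF ax2 N] D(2) linear_0[OF linT] by (metis injD inner_zero_left zero_neq_one)
  then have "dim (range T) < DIM('a)"
    using linear_surjective_imp_injective[OF linT]
    by (metis dim_eq_full dim_subset_UNIV linT linear_subspace_image order_le_imp_less_or_eq span_eq_iff subspace_UNIV)
  then obtain p0 where p0: "p0 \<noteq> 0" "\<And>v. p0 \<bullet> T v = 0"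
    using orthogonal_to_subspace_exists[of "range T"] by (metis orthogonal_def rangeI span_base)
  define p where "p = (1 / norm p0) *\<^sub>R p0"
  have p: "norm p = 1" "p \<bullet> T v = 0" for v using p0 by (auto simp: p_def)
  define M where "M v = (v \<bullet> h) *\<^sub>R p + T v" for v
  have linM: "linear M"
    by (rule linearI) (simp_all add: M_def algebra_simps blinfun.add_right blinfun.scaleR_right)
  have NM: "norm (M v) = N v" if "v \<bullet> x = 0" for v
  proof -
    have "(norm (M v))\<^sup>2 = (v \<bullet> h)\<^sup>2 * (p \<bullet> p) + (norm (T v))\<^sup>2"
      using p(2)[of v] unfolding M_def power2_norm_eq_inner
      by (simp add: inner_add_left inner_add_right inner_commute power2_eq_square algebra_simps)
    then have "(norm (M v))\<^sup>2 = (N v)\<^sup>2" using pyth[OF that] p(1) by (simp add: norm_eq_1)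
    then show ?thesis by (simp add: power2_eq_iff_nonneg)
  qed
  have sub: "subspace ?H" using subspace_hyperplane2[of x] by (simp add: inner_commute)
  have inj: "inj_on M ?H"
  proof (rule inj_onI)
    fix v w assume vw: "v \<in> ?H" "w \<in> ?H" "M v = M w"
    then have "N (v - w) = norm (M (v - w))" using NM[of "v - w"] by (simp add: inner_diff_left)
    also have "\<dots> = 0" using vw linear_diff[OF linM] by simp
    finally show "v = w" by (simp add: eq_zero_iff)
  qed
  obtain g where g: "linear g" "\<And>v. v \<in> ?H \<Longrightarrow> g (M v) = v"
    using linear_exists_left_inverse_on[OF linM sub inj] by auto
  have "subspace (M ` ?H)" using linM sub by (rule linear_subspace_image)
  moreover have "dim (M ` ?H) = dim ?H"
    using dim_image_eq[OF linM, of ?H] inj sub by (simp add: span_eq_iff[THEN iffD2])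
  moreover have "inj_on g (M ` ?H)" using g(2) by (auto simp: inj_on_def)
  moreover have "g ` M ` ?H = ?H" using g(2) by (force simp: image_iff)
  moreover have "{v. N v \<le> 1} \<inter> ?H = (\<lambda>w. g w + 0) ` (M ` ?H \<inter> cball 0 1)"
  proof (intro equalityI subsetI)
    fix v assume v: "v \<in> {v. N v \<le> 1} \<inter> ?H"
    then show "v \<in> (\<lambda>w. g w + 0) ` (M ` ?H \<inter> cball 0 1)"
      using g(2)[of v] NM[of v] by (intro image_eqI[of _ _ "M v"]) auto
  qed (use g(2) NM in auto)
  ultimately show ?thesis
    unfolding ellipsoid_in_def using g(1) subspace_0[OF sub]
    by (intro exI[of _ "M ` ?H"] exI[of _ g] exI[of _ 0] conjI)
qed

section \<open>Uniqueness of the axis of a section\<close>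

text \<open>What the uniqueness argument takes from the absence of ellipsoidal sections; both sets
  of data belong to the same section.\<close>

definition transverse_axes :: "('a::euclidean_space \<Rightarrow> real) \<Rightarrow> 'a \<Rightarrow> bool" where
  "transverse_axes N x \<longleftrightarrow>
     (\<forall>e h T e' h' T'. axial N x e h T \<longrightarrow> axial N x e' h' T' \<longrightarrow> e' \<bullet> h \<noteq> 0)"

lemma transverse_axesD:
  "transverse_axes N x \<Longrightarrow> axial N x e h T \<Longrightarrow> axial N x e' h' T' \<Longrightarrow> e' \<bullet> h \<noteq> 0"
  unfolding transverse_axes_def by blast

text \<open>A linear symmetry of the section maps axes to axes. Since \<open>r\<close> is its own
  inverse, the functional is carried by the adjoint of \<open>r\<close> and the form by composition
  with \<open>r\<close>.\<close>

lemma axial_transport: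
  fixes N :: "'a::euclidean_space \<Rightarrow> real"
  assumes ax: "axial N x e h S" and lin: "linear r" and inv: "\<And>v. r (r v) = v" and rx: "r x = x"
    and orth: "\<And>v. r v \<bullet> x = v \<bullet> x" and iso: "\<And>v. v \<bullet> x = 0 \<Longrightarrow> N (r v) = N v"
  shows "\<exists>h' S'. axial N x (r e) h' S'"
proof -
  note D = axialD[OF ax]
  define h' where "h' = adjoint r h"
  have h': "v \<bullet> h' = r v \<bullet> h" for v using adjoint_works[OF lin, of v h] by (simp add: h'_def)
  define S' where "S' = Blinfun (\<lambda>v. S (r v))"
  have "bounded_linear (\<lambda>v. S (r v))"
    using lin by (intro bounded_linear_compose[OF blinfun.bounded_linear_right]) (simp add: linear_conv_bounded_linear)
  then have S': "S' v = S (r v)" for v by (simp add: S'_def bounded_linear_Blinfun_apply)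
  have P: "rev_proj x (r e) h' v = r (rev_proj x e h (r v))" for v
    by (simp add: rev_proj_def h' linear_diff[OF lin] linear_cmul[OF lin] inv rx orth)
  have PN: "N (rev_proj x (r e) h' v) = N (rev_proj x e h (r v))" for v
    unfolding P by (rule iso) (rule rev_proj_orth[OF ax])
  have comb: "N (t *\<^sub>R r e + a *\<^sub>R rev_proj x (r e) h' v) = N (t *\<^sub>R e + a *\<^sub>R rev_proj x e h (r v))" for t a v
    unfolding P using iso[of "t *\<^sub>R e + a *\<^sub>R rev_proj x e h (r v)"] D(3) rev_proj_orth[OF ax]
    by (simp add: inner_add_left linear_add[OF lin] linear_cmul[OF lin])
  have "axial N x (r e) h' S'"
    unfolding axial_def
  proof (intro conjI allI)
    show "N (t *\<^sub>R r e + N (rev_proj x (r e) h' w) *\<^sub>R rev_proj x (r e) h' v)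
        = N (t *\<^sub>R r e + N (rev_proj x (r e) h' v) *\<^sub>R rev_proj x (r e) h' w)" for t v w
      unfolding comb PN by (rule axial_rot[OF ax]) (rule rev_proj_orth[OF ax])+
    show "h' \<bullet> x = 0" using h'[of x] D by (simp add: rx inner_commute)
    show "h' \<bullet> r e = 1" using h'[of "r e"] D by (simp add: inv inner_commute)
  qed (use D iso orth in \<open>auto simp: PN S' axial_form[OF ax]\<close>)
  then show ?thesis by blast
qed

text \<open>Reflections along vectors of a hyperplane of revolution are symmetries of the section,
  so they may be applied to any other axis.\<close>

lemma axial_reflect:
  fixes N :: "'a::euclidean_space \<Rightarrow> real"
  assumes N: "gauge_norm N" and ax: "axial N x p k T" and ax': "axial N x e h S"
    and y: "y \<bullet> x = 0" "y \<bullet> k = 0" "y \<noteq> 0"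
  shows "\<exists>h' S'. axial N x (e - (2 * (T e \<bullet> T y) / (T y \<bullet> T y)) *\<^sub>R y) h' S'"
proof -
  interpret gauge_norm N by fact
  note D = axialD[OF ax]
  \<comment> \<open>The reflection along \<open>y\<close> for the degenerate inner product pulled
    back by \<open>T\<close>; it fixes \<open>x\<close> and \<open>p\<close> because
    \<open>T\<close> vanishes on them.\<close>
  define r where "r v = v - (2 * (T v \<bullet> T y) / (T y \<bullet> T y)) *\<^sub>R y" for v
  have "norm (T y) \<noteq> 0" using axial_form'[OF ax y(1,2)] y(3) pos[of y] by simp
  then have Ty: "T y \<bullet> T y \<noteq> 0" by simp
  have Tr: "T (r v) = T v - (2 * (T v \<bullet> T y) / (T y \<bullet> T y)) *\<^sub>R T y" for v
    by (simp add: r_def blinfun.diff_right blinfun.scaleR_right)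
  have lin: "linear r"
    by (rule linearI)
      (simp_all add: r_def blinfun.add_right blinfun.scaleR_right inner_add_left distrib_left add_divide_distrib algebra_simps)
  have "T (r v) \<bullet> T y = - (T v \<bullet> T y)" for v
    using Ty unfolding Tr by (simp add: inner_diff_left)
  then have inv: "r (r v) = v" for v
    by (simp add: r_def[of "r v"]) (simp add: r_def)
  have "norm (T (r v)) = norm (T v)" for v
    unfolding norm_eq Tr using Ty by (simp add: inner_diff_left inner_diff_right inner_commute)
  then have iso0: "N (r v) = N v" if "v \<bullet> x = 0" "v \<bullet> k = 0" for v
    using axial_form'[OF ax, of v] axial_form'[OF ax, of "r v"] that y by (simp add: r_def inner_diff_left)
  have rp: "r p = p" and rx: "r x = x" by (simp_all add: r_def axial_T_zero[OF ax N])
  have iso: "N (r v) = N v" if v: "v \<bullet> x = 0" for v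
  proof -
    let ?w = "rev_proj x p k v"
    have w: "?w \<bullet> x = 0" "?w \<bullet> k = 0" using rev_proj_orth[OF ax] by auto
    have "r v = (v \<bullet> k) *\<^sub>R p + r ?w"
      by (subst axial_decomp[OF ax v]) (simp add: linear_add[OF lin] linear_cmul[OF lin] rp)
    also have "N \<dots> = N ((v \<bullet> k) *\<^sub>R p + ?w)"
      by (rule axial_rot_eq[OF ax N]) (use w y iso0 in \<open>auto simp: r_def inner_diff_left\<close>)
    finally show ?thesis using axial_decomp[OF ax v] by simp
  qed
  have "\<exists>h' S'. axial N x (r e) h' S'"
    by (rule axial_transport[OF ax' lin inv rx _ iso]) (simp_all add: r_def inner_diff_left y)
  then show ?thesis by (simp add: r_def)
qed

text \<open>
  The half turn of e about p is joined to e by the images of e under reflections; all of these are axis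
  vectors, so by transversality the sign of h2 cannot change along the way.
\<close>
lemma axial_half_turn:
  fixes N :: "'a::euclidean_space \<Rightarrow> real"
  assumes N: "gauge_norm N" and dim: "DIM('a) \<ge> 4"
    and transverse: "transverse_axes N x"
    and ax: "axial N x p k T" and ax1: "axial N x e h S" and ax2: "axial N x e2 h2 S2"
    and sgn: "e \<bullet> h2 > 0"
  shows "\<exists>h' S'. axial N x ((2 * (e \<bullet> k)) *\<^sub>R p - e) h' S'" "((2 * (e \<bullet> k)) *\<^sub>R p - e) \<bullet> h2 > 0"
proof -
  interpret gauge_norm N by fact
  define y0 where "y0 = rev_proj x p k e"
  have ey: "e = (e \<bullet> k) *\<^sub>R p + y0"
    using axial_decomp[OF ax axialD(3)[OF ax1]] by (simp add: y0_def)
  have y0: "y0 \<bullet> x = 0" "y0 \<bullet> k = 0" using rev_proj_orth[OF ax] by (auto simp: y0_def)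
  have turn: "(2 * (e \<bullet> k)) *\<^sub>R p - e = e - 2 *\<^sub>R y0"
  proof -
    have "(2 * (e \<bullet> k)) *\<^sub>R p = 2 *\<^sub>R (e - y0)" using ey by (metis add_diff_cancel_right' scaleR_scaleR)
    then show ?thesis by (simp add: scaleR_2 algebra_simps)
  qed
  have "(\<exists>h' S'. axial N x (e - 2 *\<^sub>R y0) h' S') \<and> (e - 2 *\<^sub>R y0) \<bullet> h2 > 0"
  proof (cases "y0 = 0")
    case True
    then show ?thesis using ax1 sgn by auto
  next
    case False
    have linT: "linear T" by (simp add: blinfun.bounded_linear_right bounded_linear.linear)
    \<comment> \<open>A direction orthogonal to \<open>y0\<close> for the form of \<open>T\<close>;
      rescaled to the length of \<open>y0\<close>, it lets \<open>y s\<close> rotate at constant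
      length.\<close>
    obtain z0 where z0: "z0 \<noteq> 0" "z0 \<bullet> x = 0" "z0 \<bullet> k = 0" "z0 \<bullet> adjoint T (T y0) = 0"
      using exists_orthogonal_list[of "[x, k, adjoint T (T y0)]"] dim by auto
    define z where "z = (N y0 / N z0) *\<^sub>R z0"
    have z: "z \<bullet> x = 0" "z \<bullet> k = 0" using z0 by (auto simp: z_def)
    have Tz: "T y0 \<bullet> T z = 0"
      using z0(4) adjoint_works[OF linT, of z0 "T y0"]
      by (simp add: z_def blinfun.scaleR_right inner_commute)
    have "N z = N y0" using pos[OF z0(1)] by (simp add: z_def scale)
    then have "norm (T z) = norm (T y0)"
      using axial_form'[OF ax z] axial_form'[OF ax y0] by simp
    then have Tzz: "T z \<bullet> T z = T y0 \<bullet> T y0" by (simp add: norm_eq)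
    have "norm (T y0) > 0" using axial_form'[OF ax y0] pos[OF False] by simp
    then have Tyy: "T y0 \<bullet> T y0 > 0" by simp
    have Te: "T e = T y0" using axial_T_rev_proj[OF ax N, of e] by (simp add: y0_def)
    define y where "y s = cos s *\<^sub>R y0 + sin s *\<^sub>R z" for s
    have T1: "T y0 \<bullet> T (y s) = cos s * (T y0 \<bullet> T y0)" for s
      using Tz by (simp add: y_def blinfun.add_right blinfun.scaleR_right inner_add_right)
    have T2: "T (y s) \<bullet> T (y s) = T y0 \<bullet> T y0" for s
    proof -
      have "T (y s) \<bullet> T (y s) = (cos s)\<^sup>2 * (T y0 \<bullet> T y0) + (sin s)\<^sup>2 * (T z \<bullet> T z)"
        using Tz unfolding y_def
        by (simp add: blinfun.add_right blinfun.scaleR_right inner_add_right inner_add_left inner_commute power2_eq_square)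
      then show ?thesis by (simp add: Tzz flip: distrib_right)
    qed
    have axs: "\<exists>h' S'. axial N x (e - (2 * cos s) *\<^sub>R y s) h' S'" for s
    proof -
      have "y s \<noteq> 0" using T2[of s] Tyy by (auto simp: blinfun.zero_right)
      moreover have "y s \<bullet> x = 0" "y s \<bullet> k = 0" using y0 z by (auto simp: y_def inner_add_left)
      ultimately show ?thesis
        using axial_reflect[OF N ax ax1, of "y s"] T1[of s] T2[of s] Tyy by (simp add: Te)
    qed
    \<comment> \<open>The reflected axis is \<open>e\<close> itself at \<open>s = pi/2\<close>,
      where \<open>F\<close> is positive, and the half turn \<open>e - 2 *\<^sub>R y0\<close> at
      \<open>s = 0\<close>.\<close>
    define F where "F s = (e - (2 * cos s) *\<^sub>R y s) \<bullet> h2" for s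
    have F0: "F s \<noteq> 0" for s using axs[of s] transverse_axesD[OF transverse ax2] unfolding F_def by blast
    have cont: "continuous_on {0..pi/2} F" unfolding F_def y_def by (intro continuous_intros)
    have "F 0 > 0"
    proof (rule ccontr)
      assume "\<not> F 0 > 0"
      moreover have "F (pi/2) > 0" using sgn by (simp add: F_def)
      ultimately have "\<exists>s\<ge>0. s \<le> pi/2 \<and> F s = 0" using cont by (intro IVT') auto
      then show False using F0 by blast
    qed
    then show ?thesis using axs[of 0] by (simp add: F_def y_def)
  qed
  then show "\<exists>h' S'. axial N x ((2 * (e \<bullet> k)) *\<^sub>R p - e) h' S'" "((2 * (e \<bullet> k)) *\<^sub>R p - e) \<bullet> h2 > 0"
    unfolding turn by auto
qed

text \<open>
  The half turn of e about p has h-value \<open>2 (e \<bullet> k) (p \<bullet> h) - 1 \<le> 2 (p \<bullet> h) - 1\<close>, so the infimum m of the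
  positive h-values of axis vectors satisfies \<open>m \<le> 2 m - 1\<close>.
\<close>
lemma axial_cos_eq_1:
  fixes N :: "'a::euclidean_space \<Rightarrow> real"
  assumes N: "gauge_norm N" and dim: "DIM('a) \<ge> 4"
    and transverse: "transverse_axes N x"
    and ax: "axial N x e h S" and axp: "axial N x p k T" and sgn: "p \<bullet> h > 0"
  shows "p \<bullet> h = 1" "e \<bullet> k = 1"
proof -
  interpret gauge_norm N by fact
  define Q where "Q = {q \<bullet> h | q k T. axial N x q k T \<and> q \<bullet> h > 0}"
  have bdd: "bdd_below Q" by (rule bdd_belowI[of _ 0]) (auto simp: Q_def)
  have step: "Inf Q \<le> 2 * (e \<bullet> k) * (q \<bullet> h) - 1 \<and> e \<bullet> k \<le> 1 \<and> q \<bullet> h \<le> 1"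
    if q: "axial N x q k T" "q \<bullet> h > 0" for q k T
  proof -
    have "e \<bullet> h > 0" using axialD[OF ax] by simp
    note turn = axial_half_turn[OF N dim transverse q(1) ax ax this]
    from turn have "((2 * (e \<bullet> k)) *\<^sub>R q - e) \<bullet> h \<in> Q" unfolding Q_def by blast
    then have "Inf Q \<le> ((2 * (e \<bullet> k)) *\<^sub>R q - e) \<bullet> h" using bdd by (rule cInf_lower)
    moreover have "\<bar>e \<bullet> k\<bar> \<le> N e" "\<bar>q \<bullet> h\<bar> \<le> N q"
      using axial_functional_le[OF q(1) N, of e] axial_functional_le[OF ax N, of q] axialD[OF ax] axialD[OF q(1)] by auto
    ultimately show ?thesis using axialD[OF ax] axialD[OF q(1)] by (simp add: inner_diff_left abs_le_iff)
  qed
  have "(1 + Inf Q) / 2 \<le> Inf Q"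
  proof (rule cInf_greatest)
    show "Q \<noteq> {}" using axp sgn by (auto simp: Q_def)
    fix c assume "c \<in> Q"
    then obtain q k T where q: "axial N x q k T" "q \<bullet> h > 0" "c = q \<bullet> h" by (auto simp: Q_def)
    have "(e \<bullet> k) * (q \<bullet> h) \<le> 1 * (q \<bullet> h)" using step[OF q(1,2)] q(2) by (intro mult_right_mono) auto
    then show "(1 + Inf Q) / 2 \<le> c" using step[OF q(1,2)] q(3) by simp
  qed
  then have m: "Inf Q \<ge> 1" by simp
  have "p \<bullet> h \<in> Q" using axp sgn by (auto simp: Q_def)
  then have "p \<bullet> h \<ge> 1" using m bdd by (meson cInf_lower order_trans)
  then show "p \<bullet> h = 1" using step[OF axp sgn] by simp
  \<comment> \<open>With \<open>p \<bullet> h = 1\<close>, the bound reads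
    \<open>1 \<le> Inf Q \<le> 2 * (e \<bullet> k) - 1\<close>, while
    \<open>e \<bullet> k \<le> 1\<close>.\<close>
  then show "e \<bullet> k = 1" using step[OF axp sgn] m by simp
qed

text \<open>The functionals involved take the value 1 on the axis vectors involved, so the half turn
  of \<open>q\<close> about \<open>p\<close> is the point reflection \<open>2 p - q\<close>.
  Iterating it yields infinitely many equally spaced vectors of norm 1.\<close>

lemma axial_unique_pos:
  fixes N :: "'a::euclidean_space \<Rightarrow> real"
  assumes N: "gauge_norm N" and dim: "DIM('a) \<ge> 4"
    and transverse: "transverse_axes N x"
    and ax: "axial N x e h T" and ax': "axial N x e' h' T'" and sgn: "e' \<bullet> h > 0"
  shows "e' = e"
proof (rule ccontr)
  assume ne: "e' \<noteq> e"
  interpret gauge_norm N by fact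
  note cos1 = axial_cos_eq_1[OF N dim transverse]
  note D = axialD[OF ax] axialD[OF ax']
  define y where "y = e' - e"
  have eh: "e' \<bullet> h = 1" "e \<bullet> h' = 1" using cos1[OF ax ax' sgn] by auto
  have yh: "y \<bullet> h = 0" "y \<bullet> h' = 0" using eh D by (auto simp: y_def inner_diff_left)
  define A where "A p \<longleftrightarrow> (\<exists>k S. axial N x p k S)" for p
  have "A (e + real n *\<^sub>R y) \<and> A (e + real (Suc n) *\<^sub>R y)" for n
  proof (induction n)
    case 0
    then show ?case using ax ax' by (auto simp: A_def y_def)
  next
    case (Suc n)
    define p q where "p = e + real (Suc n) *\<^sub>R y" and "q = e + real n *\<^sub>R y"
    obtain k S where p: "axial N x p k S" using Suc by (auto simp: A_def p_def)
    obtain k' S' where q: "axial N x q k' S'" using Suc by (auto simp: A_def q_def)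
    have ph: "p \<bullet> h = 1" "p \<bullet> h' = 1" using D eh yh by (auto simp: p_def inner_add_left)
    \<comment> \<open>The value of \<open>k\<close> is 1 at \<open>e\<close> and \<open>e'\<close>,
      hence on the whole line through them, which contains \<open>q\<close>.\<close>
    have "e \<bullet> k = 1" "e' \<bullet> k = 1" using cos1(2)[OF ax p] cos1(2)[OF ax' p] ph by auto
    then have qk: "q \<bullet> k = 1" by (simp add: q_def y_def inner_add_left inner_diff_left)
    have "A ((2 * (q \<bullet> k)) *\<^sub>R p - q)"
      unfolding A_def by (rule axial_half_turn(1)[OF N dim transverse p q p]) (use qk in auto)
    moreover have "(2 * (q \<bullet> k)) *\<^sub>R p - q = e + real (Suc (Suc n)) *\<^sub>R y"
      unfolding qk by (simp add: p_def q_def algebra_simps flip: scaleR_2)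
    ultimately show ?case using Suc by simp
  qed
  then have N1: "N (e + real n *\<^sub>R y) = 1" for n using axialD(9) unfolding A_def by blast
  have "real n * N y \<le> 2" for n
  proof -
    have "real n * N y = N ((e + real n *\<^sub>R y) + - e)" by (simp add: scale)
    also have "\<dots> \<le> 2" using triangle[of "e + real n *\<^sub>R y" "- e"] N1[of n] D by simp
    finally show ?thesis .
  qed
  moreover have "N y > 0" using ne by (intro pos) (simp add: y_def)
  ultimately show False by (meson reals_Archimedean3 not_less)
qed

lemma axial_unique:
  fixes N :: "'a::euclidean_space \<Rightarrow> real"
  assumes N: "gauge_norm N" and dim: "DIM('a) \<ge> 4"
    and transverse: "transverse_axes N x"
    and ax: "axial N x e h T" and ax': "axial N x e' h' T'"
  shows "e' = e \<or> e' = - e"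
proof (cases "e' \<bullet> h > 0")
  case True
  then show ?thesis using axial_unique_pos[OF N dim transverse ax ax'] by simp
next
  case False
  then have "e' \<bullet> (- h) > 0" using transverse_axesD[OF transverse ax ax'] by (simp add: less_le)
  then show ?thesis using axial_unique_pos[OF N dim transverse axial_uminus[OF N ax] ax'] by simp
qed

section \<open>Compactness of the axial data\<close>

text \<open>Prepares a closed graph argument: continuous images of this set are compact, which
  yields continuity in \<open>x\<close> without a continuous choice of axis.\<close>

lemma compact_axial:
  fixes N :: "'a::euclidean_space \<Rightarrow> real"
  assumes N: "gauge_norm N"
  shows "compact {(x, e, h, T). axial N x e h T}"
proof -
  interpret gauge_norm N by fact
  have [continuous_intros]: "continuous_on A (\<lambda>q. N (f q))" if "continuous_on A f"
    for A and f :: "'b::topological_space \<Rightarrow> 'a"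
    using continuous_on_compose[OF that continuous] by (simp add: o_def)
  have [continuous_intros]: "continuous_on UNIV (\<lambda>q. blinfun_apply (snd (snd (snd q))) v)"
    for v :: 'a and q :: "'a \<times> 'a \<times> 'a \<times> ('a \<Rightarrow>\<^sub>L 'a)"
    by (intro blinfun.continuous_on continuous_intros)
  have "closed {q. axial N (fst q) (fst (snd q)) (fst (snd (snd q))) (snd (snd (snd q)))}"
    unfolding axial_def rev_proj_def
    by (intro closed_Collect_conj closed_Collect_all closed_Collect_eq continuous_intros)
  moreover have "bounded {q. axial N (fst q) (fst (snd q)) (fst (snd (snd q))) (snd (snd (snd q)))}"
  proof -
    obtain C where C: "C > 0" "\<And>v. N v \<le> C * norm v" using upper_bound by blast
    obtain D where D: "D > 0" "\<And>v. norm v \<le> D * N v" using lower_bound by blast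
    have "norm e \<le> D \<and> norm h \<le> C \<and> norm T \<le> C * (2 + C * D)" if ax: "axial N x e h T" for x e h T
    proof (intro conjI)
      note X = axialD[OF ax]
      show e: "norm e \<le> D" using D(2)[of e] X by simp
      \<comment> \<open>The functional bound is applied to \<open>h\<close> itself.\<close>
      have "norm h * norm h \<le> C * norm h"
        using axial_functional_le[OF ax N X(5)] C(2)[of h] by (simp add: norm_eq_sqrt_inner)
      then show h: "norm h \<le> C" using C(1) by (cases "h = 0") auto
      show "norm T \<le> C * (2 + C * D)"
      proof (rule norm_blinfun_bound)
        show "0 \<le> C * (2 + C * D)" using C(1) D(1) by simp
        fix v
        have "norm ((v \<bullet> x) *\<^sub>R x) \<le> norm v" using Cauchy_Schwarz_ineq2[of v x] X by simp
        moreover have "norm ((v \<bullet> h) *\<^sub>R e) \<le> (norm v * C) * D"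
          unfolding norm_scaleR
          by (intro mult_mono order_trans[OF Cauchy_Schwarz_ineq2] mult_left_mono e h) (use C D in auto)
        ultimately have "norm (rev_proj x e h v) \<le> norm v + norm v + norm v * C * D"
          unfolding rev_proj_def
          by (smt (verit) norm_triangle_ineq4)
        then have "C * norm (rev_proj x e h v) \<le> C * (norm v + norm v + norm v * C * D)"
          using C(1) by simp
        then show "norm (T v) \<le> C * (2 + C * D) * norm v"
          using axial_form[OF ax, of v] C(2)[of "rev_proj x e h v"] by (simp add: algebra_simps)
      qed
    qed
    then have "{q. axial N (fst q) (fst (snd q)) (fst (snd (snd q))) (snd (snd (snd q)))}
        \<subseteq> cball 0 1 \<times> cball 0 D \<times> cball 0 C \<times> cball 0 (C * (2 + C * D))"
      using axialD(1) by fastforce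
    then show ?thesis by (rule bounded_subset[rotated]) (intro bounded_Times bounded_cball)
  qed
  ultimately show ?thesis
    by (simp add: compact_eq_bounded_closed case_prod_unfold)
qed

section \<open>The winding obstruction and the conclusion\<close>

text \<open>As the factor is real, the imaginary part of \<open>g\<close> minus twice the angle is
  always a multiple of \<open>pi\<close>. By continuity it would be constant, yet it drops by
  \<open>4 * pi\<close> in one turn.\<close>

lemma no_continuous_log_double_winding:
  fixes g :: "'a::euclidean_space \<Rightarrow> complex"
  assumes g: "continuous_on (sphere 0 1) g"
    and ab: "norm a = 1" "norm b = 1" "a \<bullet> b = 0"
    and exp_g: "\<And>\<theta>. \<exists>\<rho>::real. exp (g (cos \<theta> *\<^sub>R a + sin \<theta> *\<^sub>R b)) = of_real \<rho> * exp (\<i> * of_real (2 * \<theta>))"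
  shows False
proof -
  define c where "c \<theta> = cos \<theta> *\<^sub>R a + sin \<theta> *\<^sub>R b" for \<theta> :: real
  have c: "c \<theta> \<in> sphere 0 1" for \<theta>
  proof -
    have "c \<theta> \<bullet> c \<theta> = (cos \<theta>)\<^sup>2 * (a \<bullet> a) + (sin \<theta>)\<^sup>2 * (b \<bullet> b)"
      using ab(3) by (simp add: c_def inner_add_left inner_add_right inner_commute power2_eq_square)
    then show ?thesis using ab by (simp add: norm_eq_1)
  qed
  define \<phi> where "\<phi> \<theta> = Im (g (c \<theta>)) - 2 * \<theta>" for \<theta>
  have cont: "continuous_on {0..2*pi} \<phi>"
    unfolding \<phi>_def
    by (intro continuous_intros continuous_on_compose2[OF g]) (use c in \<open>auto simp: c_def intro!: continuous_intros\<close>)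
  have sin0: "sin (\<phi> \<theta>) = 0" for \<theta>
  proof -
    obtain \<rho> :: real where \<rho>: "exp (g (c \<theta>)) = of_real \<rho> * exp (\<i> * of_real (2 * \<theta>))"
      using exp_g unfolding c_def by blast
    have "exp (g (c \<theta>) - \<i> * of_real (2 * \<theta>)) = of_real \<rho>"
      by (simp add: exp_diff \<rho>)
    then have "Im (exp (g (c \<theta>) - \<i> * of_real (2 * \<theta>))) = 0" by simp
    then show ?thesis by (simp add: Im_exp \<phi>_def)
  qed
  have "c (2 * pi) = c 0" by (simp add: c_def)
  then have end_val: "\<phi> (2 * pi) = \<phi> 0 - 4 * pi" by (simp add: \<phi>_def)
  \<comment> \<open>An intermediate value halfway between two consecutive multiples of
    \<open>pi\<close>, where the sine cannot vanish.\<close>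
  have "\<exists>\<theta>\<ge>0. \<theta> \<le> 2 * pi \<and> \<phi> \<theta> = \<phi> 0 - pi / 2"
    using cont end_val pi_gt_zero by (intro IVT2') auto
  then obtain \<theta> where "\<phi> \<theta> = \<phi> 0 - pi / 2" by blast
  then have "cos (\<phi> 0) = 0" using sin0[of \<theta>] by (simp add: sin_diff)
  then show False using sin0[of 0] sin_cos_squared_add[of "\<phi> 0"] by simp
qed

theorem theorem3:
  fixes B :: "'a::euclidean_space set"
  assumes "DIM('a) \<ge> 5"
    and "sym_convex_body_in UNIV B"
    and "\<And>H. linear_hyperplane H \<Longrightarrow> affine_sym_body_of_revolution_in H (B \<inter> H)"
  shows "\<exists>H. linear_hyperplane H \<and> ellipsoid_in H (B \<inter> H)"
proof (rule ccontr)
  assume no_ell: "\<not> ?thesis"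
  obtain N where N: "gauge_norm N" and B: "B = {v. N v \<le> 1}"
    using sym_convex_body_gauge[OF assms(2)] by blast
  have transverse: "\<not> (e' \<bullet> x = 0 \<and> e' \<bullet> h = 0)" if ax: "axial N x e h T" "axial N x' e' h' T'" for x e h T x' e' h' T'
  proof
    assume "e' \<bullet> x = 0 \<and> e' \<bullet> h = 0"
    then have "ellipsoid_in {v. v \<bullet> x' = 0} (B \<inter> {v. v \<bullet> x' = 0})"
      using ellipsoid_of_axis_in_rev_hyperplane[OF N assms(1) ax] B by simp
    moreover have "x' \<noteq> 0" using axialD(1)[OF ax(2)] by auto
    ultimately show False using no_ell linear_hyperplane_orth by blast
  qed
  have unique: "e' = e \<or> e' = - e" if "axial N x e h T" "axial N x e' h' T'" for x e h T e' h' T'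
  proof (rule axial_unique[OF N _ _ that])
    show "DIM('a) \<ge> 4" using assms(1) by simp
    show "transverse_axes N x"
      unfolding transverse_axes_def using transverse axialD(3) by blast
  qed
  have ex: "\<exists>e h T. axial N x e h T" if "norm x = 1" for x
  proof (rule axial_exists[OF N that])
    have "x \<noteq> 0" using that by auto
    then show "affine_sym_body_of_revolution_in {v. v \<bullet> x = 0} ({v. N v \<le> 1} \<inter> {v. v \<bullet> x = 0})"
      using assms(3)[OF linear_hyperplane_orth] B by simp
  qed
  obtain a :: 'a where a: "norm a = 1" using vector_choose_size[of 1] by auto
  obtain e1 h1 T1 where ax1: "axial N a e1 h1 T1" using ex[OF a] by blast
  have "h1 \<noteq> 0" using axialD(7)[OF ax1] by auto
  define b where "b = (1 / norm h1) *\<^sub>R h1"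
  have b: "norm b = 1" "a \<bullet> b = 0" using \<open>h1 \<noteq> 0\<close> axialD(6)[OF ax1] by (auto simp: b_def)
  \<comment> \<open>Coordinates of the projection to the plane spanned by \<open>a\<close> and
    \<open>b\<close>, the orthogonal complement of the fixed hyperplane of revolution.\<close>
  define w where "w e = Complex (e \<bullet> a) (e \<bullet> b)" for e
  have w0: "w e \<noteq> 0" if "axial N x e h T" for x e h T
    using transverse[OF ax1 that] \<open>h1 \<noteq> 0\<close> by (auto simp: w_def b_def complex_eq_iff)
  \<comment> \<open>Squaring removes the sign ambiguity of the axis vector, so the value does not
    depend on the choice.\<close>
  define z where "z x = (w (SOME e. \<exists>h T. axial N x e h T))\<^sup>2" for x
  have z: "z x = (w e)\<^sup>2" if ax: "axial N x e h T" for x e h T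
  proof -
    define e' where "e' = (SOME e. \<exists>h T. axial N x e h T)"
    have "\<exists>h T. axial N x e' h T" unfolding e'_def by (rule someI) (use ax in blast)
    then have "e' = e \<or> e' = - e" using unique[OF ax] by blast
    moreover have "w (- e) = - w e" by (simp add: w_def complex_eq_iff)
    ultimately show ?thesis by (auto simp: z_def simp flip: e'_def)
  qed
  \<comment> \<open>The graph of \<open>z\<close> is a continuous image of the compact set of axial
    data; a closed graph with values in a compact set gives continuity.\<close>
  have graph: "(\<lambda>x. (x, z x)) ` sphere 0 1 = (\<lambda>(x, e, h, T). (x, (w e)\<^sup>2)) ` {(x, e, h, T). axial N x e h T}"
  proof (intro equalityI subsetI)
    fix q assume "q \<in> (\<lambda>x. (x, z x)) ` sphere 0 1"
    then obtain x where x: "norm x = 1" "q = (x, z x)" by auto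
    obtain e h T where "axial N x e h T" using ex[OF x(1)] by blast
    then show "q \<in> (\<lambda>(x, e, h, T). (x, (w e)\<^sup>2)) ` {(x, e, h, T). axial N x e h T}"
      using x(2) z by (intro image_eqI[of _ _ "(x, e, h, T)"]) auto
  next
    fix q assume "q \<in> (\<lambda>(x, e, h, T). (x, (w e)\<^sup>2)) ` {(x, e, h, T). axial N x e h T}"
    then obtain x e h T where "axial N x e h T" "q = (x, (w e)\<^sup>2)" by auto
    then show "q \<in> (\<lambda>x. (x, z x)) ` sphere 0 1" using z axialD(1) by (intro image_eqI[of _ _ x]) auto
  qed
  have "compact ((\<lambda>(x, e, h, T). (x, (w e)\<^sup>2)) ` {(x, e, h, T). axial N x e h T})"
    unfolding w_def case_prod_unfold
    by (intro compact_continuous_image compact_axial[OF N, unfolded case_prod_unfold] continuous_intros)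
  then have comp: "compact ((\<lambda>x. (x, z x)) ` sphere 0 1)" by (simp add: graph)
  have "compact (snd ` (\<lambda>x. (x, z x)) ` sphere 0 1)"
    by (rule compact_continuous_image[OF _ comp]) (intro continuous_intros)
  then have "continuous_on (sphere 0 1) z"
    by (rule continuous_from_closed_graph) (auto intro!: compact_imp_closed[OF comp] image_eqI)
  moreover have "z \<in> sphere 0 1 \<rightarrow> - {0}" using ex z w0 by fastforce
  moreover have "Borsukian (sphere (0::'a) 1)" using assms(1) by (intro Borsukian_sphere) simp
  ultimately obtain g where g: "continuous_on (sphere 0 1) g" "\<And>x. x \<in> sphere 0 1 \<Longrightarrow> z x = exp (g x)"
    unfolding Borsukian_continuous_logarithm by blast
  show False
  proof (rule no_continuous_log_double_winding[OF g(1) a b])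
    fix \<theta> :: real
    define x where "x = cos \<theta> *\<^sub>R a + sin \<theta> *\<^sub>R b"
    have "x \<bullet> x = (cos \<theta>)\<^sup>2 * (a \<bullet> a) + (sin \<theta>)\<^sup>2 * (b \<bullet> b)"
      using b(2) by (simp add: x_def inner_add_left inner_add_right inner_commute power2_eq_square)
    then have x: "norm x = 1" using a b by (simp add: norm_eq_1)
    obtain e h T where ax: "axial N x e h T" using ex[OF x] by blast
    have orth: "cos \<theta> * (e \<bullet> a) + sin \<theta> * (e \<bullet> b) = 0"
      using axialD(3)[OF ax] by (simp add: x_def inner_add_right)
    \<comment> \<open>The projected axis is orthogonal to \<open>x\<close>, hence a real multiple of
      \<open>x\<close> turned by a right angle in the plane; this is its signed length.\<close>
    define \<rho> where "\<rho> = cos \<theta> * (e \<bullet> b) - sin \<theta> * (e \<bullet> a)"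
    have "e \<bullet> a = - \<rho> * sin \<theta>"
    proof -
      have "- \<rho> * sin \<theta> = ((sin \<theta>)\<^sup>2 + (cos \<theta>)\<^sup>2) * (e \<bullet> a) - cos \<theta> * (cos \<theta> * (e \<bullet> a) + sin \<theta> * (e \<bullet> b))"
        unfolding \<rho>_def by algebra
      then show ?thesis using orth by simp
    qed
    moreover have "e \<bullet> b = \<rho> * cos \<theta>"
    proof -
      have "\<rho> * cos \<theta> = ((sin \<theta>)\<^sup>2 + (cos \<theta>)\<^sup>2) * (e \<bullet> b) - sin \<theta> * (cos \<theta> * (e \<bullet> a) + sin \<theta> * (e \<bullet> b))"
        unfolding \<rho>_def by algebra
      then show ?thesis using orth by simp
    qed
    ultimately have "w e = of_real \<rho> * \<i> * cis \<theta>" by (simp add: w_def complex_eq_iff)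
    then have "(w e)\<^sup>2 = of_real (- \<rho>\<^sup>2) * cis (2 * \<theta>)"
      by (simp add: power_mult_distrib cis_mult power2_eq_square[of "cis \<theta>"])
    then have "exp (g x) = of_real (- \<rho>\<^sup>2) * exp (\<i> * of_real (2 * \<theta>))"
      using z[OF ax] g(2)[of x] x by (simp add: cis_conv_exp)
    then show "\<exists>\<rho>::real. exp (g (cos \<theta> *\<^sub>R a + sin \<theta> *\<^sub>R b)) = of_real \<rho> * exp (\<i> * of_real (2 * \<theta>))"
      unfolding x_def by blast
  qed
qed

end
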